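(* A tree $T$ is an EOCD graph if and only if $T$ can be obtained from $K_2$ by a sequence of operations $O_1$–$O_5$.
   Context: Graphs are finite and simple. A set $P\subseteq V(G)$ is an ECD set if the closed neighborhoods $N[v]$, $v\in P$, partition $V(G)$; a set $D\subseteq V(G)$ is an EOD set if the open neighborhoods $N(v)$, $v\in D$, partition $V(G)$; $G$ is an EOCD graph if it has both. The operations are applied to an EOCD tree $T'$ together with a chosen EOD set $D'$ and ECD set $P'$ of $T'$ (degrees are taken in $T'$): $(O_1)$ For $u\in D'\cap P'$, obtain $T$ from $T'$ by adding a vertex $v$ and the edge $uv$. $(O_2)$ For $w\notin D'$, obtain $T$ from $T'$ by adding a new path $xuv$ and the edge $wx$. $(O_3)$ For $t\in D'-P'$, obtain $T$ from $T'$ by adding a new path $zwxuv$ and the edge $tz$. $(O_4)$ For a path $vux$ in $T'$ with $\deg(v)=1$, $\deg(u)=2$, $u,x\in D'$ and $u\in P'$, obtain $T$ from $T'$ by adding a vertex $y$ and the edge $yx$. $(O_5)$ For a path $uxwzw'x'$ in $T'$ with $\deg(u)=\deg(x')=1$, $\deg(x)=\deg(w)=\deg(w')=2$, $u,x,w',x'\in D'$ and $x,w'\in P'$, obtain $T$ from $T'$ by adding a vertex $v$ and the edge $uv$. A sequence starting from $K_2$ means each operation is applied to the tree produced so far, with respect to some EOD set and ECD set of that tree. *)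

theory Defs
  imports "Graph_Theory.Graph_Theory" "HOL-Library.Disjoint_Sets"
begin

text \<open>
  A finite simple graph is a value of type \<^typ>\<open>'a pair_pre_digraph\<close> satisfying
  \<^const>\<open>pair_graph\<close>: a finite, loop-free, symmetric digraph without parallel arcs. An edge
  \<open>uv\<close> is the pair of arcs \<open>(u, v)\<close>, \<open>(v, u)\<close>.
\<close>

text \<open>
  The constant \<open>tree\<close> of the digraph library cannot be used here: in a symmetric digraph every
  edge forms a directed cycle of length 2. The cycles of the undirected graph are those of
  length at least 3. \<^const>\<open>connected\<close> excludes the null graph.
\<close>

definition graph_tree :: "'a pair_pre_digraph \<Rightarrow> bool" where
  "graph_tree G \<longleftrightarrow> pair_graph G \<and> connected (with_proj G)
     \<and> \<not> (\<exists>p. pre_digraph.cycle (with_proj G) p \<and> 3 \<le> length p)"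

definition open_nbhd :: "'a pair_pre_digraph \<Rightarrow> 'a \<Rightarrow> 'a set" where
  "open_nbhd G v = {w. v \<rightarrow>\<^bsub>with_proj G\<^esub> w}"

definition closed_nbhd :: "'a pair_pre_digraph \<Rightarrow> 'a \<Rightarrow> 'a set" where
  "closed_nbhd G v = insert v (open_nbhd G v)"

text \<open>
  The partition is one into indexed blocks: distinct vertices of the set have disjoint
  neighbourhoods.
\<close>

definition ECD_set :: "'a pair_pre_digraph \<Rightarrow> 'a set \<Rightarrow> bool" where
  "ECD_set G P \<longleftrightarrow> P \<subseteq> pverts G \<and> disjoint_family_on (closed_nbhd G) P
     \<and> (\<Union>v\<in>P. closed_nbhd G v) = pverts G"

definition EOD_set :: "'a pair_pre_digraph \<Rightarrow> 'a set \<Rightarrow> bool" where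
  "EOD_set G D \<longleftrightarrow> D \<subseteq> pverts G \<and> disjoint_family_on (open_nbhd G) D
     \<and> (\<Union>v\<in>D. open_nbhd G v) = pverts G"

definition EOCD_graph :: "'a pair_pre_digraph \<Rightarrow> bool" where
  "EOCD_graph G \<longleftrightarrow> pair_graph G \<and> (\<exists>D. EOD_set G D) \<and> (\<exists>P. ECD_set G P)"

text \<open>In a symmetric digraph the out-degree is the degree of the undirected graph.\<close>

abbreviation degree :: "'a pair_pre_digraph \<Rightarrow> 'a \<Rightarrow> nat" where
  "degree G \<equiv> out_degree (with_proj G)"

definition extend :: "'a pair_pre_digraph \<Rightarrow> 'a set \<Rightarrow> ('a \<times> 'a) set \<Rightarrow> 'a pair_pre_digraph" where
  "extend G W E = \<lparr> pverts = pverts G \<union> W, parcs = parcs G \<union> E \<union> E\<inverse> \<rparr>"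

text \<open>
  In each operation \<open>G\<close> is the given tree, \<open>D\<close> its chosen EOD set, \<open>P\<close> its chosen ECD set and
  \<open>H\<close> the result.
\<close>

definition op_O1 :: "'a pair_pre_digraph \<Rightarrow> 'a set \<Rightarrow> 'a set \<Rightarrow> 'a pair_pre_digraph \<Rightarrow> bool" where
  "op_O1 G D P H \<longleftrightarrow> (\<exists>u v. u \<in> D \<inter> P \<and> v \<notin> pverts G \<and> H = extend G {v} {(u, v)})"

definition op_O2 :: "'a pair_pre_digraph \<Rightarrow> 'a set \<Rightarrow> 'a set \<Rightarrow> 'a pair_pre_digraph \<Rightarrow> bool" where
  "op_O2 G D P H \<longleftrightarrow> (\<exists>w x u v. w \<in> pverts G \<and> w \<notin> D
     \<and> distinct [x, u, v] \<and> {x, u, v} \<inter> pverts G = {}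
     \<and> H = extend G {x, u, v} {(x, u), (u, v), (w, x)})"

definition op_O3 :: "'a pair_pre_digraph \<Rightarrow> 'a set \<Rightarrow> 'a set \<Rightarrow> 'a pair_pre_digraph \<Rightarrow> bool" where
  "op_O3 G D P H \<longleftrightarrow> (\<exists>t z w x u v. t \<in> D - P
     \<and> distinct [z, w, x, u, v] \<and> {z, w, x, u, v} \<inter> pverts G = {}
     \<and> H = extend G {z, w, x, u, v} {(z, w), (w, x), (x, u), (u, v), (t, z)})"

definition op_O4 :: "'a pair_pre_digraph \<Rightarrow> 'a set \<Rightarrow> 'a set \<Rightarrow> 'a pair_pre_digraph \<Rightarrow> bool" where
  "op_O4 G D P H \<longleftrightarrow> (\<exists>v u x y. vpath [v, u, x] (with_proj G)
     \<and> degree G v = 1 \<and> degree G u = 2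
     \<and> u \<in> D \<and> x \<in> D \<and> u \<in> P
     \<and> y \<notin> pverts G \<and> H = extend G {y} {(y, x)})"

definition op_O5 :: "'a pair_pre_digraph \<Rightarrow> 'a set \<Rightarrow> 'a set \<Rightarrow> 'a pair_pre_digraph \<Rightarrow> bool" where
  "op_O5 G D P H \<longleftrightarrow> (\<exists>u x w z w' x' v. vpath [u, x, w, z, w', x'] (with_proj G)
     \<and> degree G u = 1 \<and> degree G x' = 1
     \<and> degree G x = 2 \<and> degree G w = 2 \<and> degree G w' = 2
     \<and> u \<in> D \<and> x \<in> D \<and> w' \<in> D \<and> x' \<in> D \<and> x \<in> P \<and> w' \<in> P
     \<and> v \<notin> pverts G \<and> H = extend G {v} {(u, v)})"

definition EOCD_step :: "'a pair_pre_digraph \<Rightarrow> 'a pair_pre_digraph \<Rightarrow> bool" where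
  "EOCD_step G H \<longleftrightarrow> graph_tree G \<and> (\<exists>D P. EOD_set G D \<and> ECD_set G P
     \<and> (op_O1 G D P H \<or> op_O2 G D P H \<or> op_O3 G D P H \<or> op_O4 G D P H \<or> op_O5 G D P H))"

text \<open>
  Both the initial \<open>K\<^sub>2\<close> and the added vertices may be chosen arbitrarily in the vertex type, so
  the obtainable graphs are closed under relabelling within the type. Since the operations only
  add vertices and edges, every graph in a sequence leading to \<open>T\<close> is a subgraph of \<open>T\<close>, and
  no vertices outside \<open>T\<close> are ever needed.
\<close>

definition obtainable_from_K2 :: "'a pair_pre_digraph \<Rightarrow> bool" where
  "obtainable_from_K2 T \<longleftrightarrow> (\<exists>K. K\<^bsub>2\<^esub> (with_proj K) \<and> EOCD_step\<^sup>*\<^sup>* K T)"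

end

theory Submission
  imports Defs
begin

text \<open>
  Each operation preserves being an EOCD graph: the EOD set is kept or enlarged by new vertices, while
  the ECD set is enlarged for \<open>O\<^sub>1\<close>, \<open>O\<^sub>2\<close>, \<open>O\<^sub>3\<close> and shifted along the pendant path for \<open>O\<^sub>4\<close>, \<open>O\<^sub>5\<close>.

  Conversely, let \<open>T\<close> be an EOCD tree that no operation produces from a smaller EOCD tree, with EOD set
  \<open>D\<close> and ECD set \<open>P\<close>. By \<open>O\<^sub>1\<close> no two leaves share a neighbour. Let \<open>u\<close> be the parent of \<open>c\<close> for some choice
  of root. If the subtree at \<open>c\<close> has height 2, then \<open>O\<^sub>2\<close> and \<open>O\<^sub>4\<close> force \<open>c\<close> to have a single child, \<open>c \<in> D\<close>
  and \<open>u \<in> P\<close>. At height 3 it follows that \<open>c\<close> has a single child and lies in \<open>P - D\<close>. Height 4 is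
  impossible: if \<open>c\<close> has only one child, then \<open>O\<^sub>3\<close> produces \<open>T\<close>, and otherwise the second child is the
  neighbour of a leaf and \<open>O\<^sub>5\<close> does. Rooting \<open>T\<close> at a leaf now leaves only \<open>K\<^sub>2\<close>.
\<close>

section \<open>Neighbourhood partitions\<close>

lemma open_nbhd_iff [simp]: "w \<in> open_nbhd G v \<longleftrightarrow> (v, w) \<in> parcs G"
  by (simp add: open_nbhd_def)

lemma pair_graph_iff:
  "pair_graph G \<longleftrightarrow> finite (pverts G) \<and> parcs G \<subseteq> pverts G \<times> pverts G \<and> sym (parcs G) \<and> irrefl (parcs G)"
proof
  assume "pair_graph G"
  then interpret pair_graph G .
  show "finite (pverts G) \<and> parcs G \<subseteq> pverts G \<times> pverts G \<and> sym (parcs G) \<and> irrefl (parcs G)"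
    using in_arcsD1 in_arcsD2 sym_arcs no_loops' by (auto simp: symmetric_def irrefl_def) blast
next
  assume *: "finite (pverts G) \<and> parcs G \<subseteq> pverts G \<times> pverts G \<and> sym (parcs G) \<and> irrefl (parcs G)"
  then have "finite (parcs G)"
    by (meson finite_SigmaI finite_subset)
  with * show "pair_graph G"
    by unfold_locales (auto simp: symmetric_def irrefl_def)
qed

text \<open>Covering supplies the existence and disjointness the uniqueness of the block; since all
  blocks lie in \<open>V\<close>, a point shared by two blocks is a point of
  \<open>V\<close>.\<close>

lemma indexed_partition_iff:
  assumes "\<And>i. i \<in> I \<Longrightarrow> A i \<subseteq> V"
  shows "disjoint_family_on A I \<and> (\<Union>i\<in>I. A i) = V \<longleftrightarrow> (\<forall>v\<in>V. \<exists>!i. i \<in> I \<and> v \<in> A i)"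
proof -
  have "(\<Union>i\<in>I. A i) = V \<longleftrightarrow> (\<forall>v\<in>V. \<exists>i\<in>I. v \<in> A i)"
    using assms by blast
  moreover have "disjoint_family_on A I \<longleftrightarrow> (\<forall>v\<in>V. \<forall>i\<in>I. \<forall>j\<in>I. v \<in> A i \<longrightarrow> v \<in> A j \<longrightarrow> i = j)"
    unfolding disjoint_family_on_def disjoint_iff using assms by blast
  moreover have "(\<exists>!i. i \<in> I \<and> v \<in> A i) \<longleftrightarrow>
      (\<forall>i\<in>I. \<forall>j\<in>I. v \<in> A i \<longrightarrow> v \<in> A j \<longrightarrow> i = j) \<and> (\<exists>i\<in>I. v \<in> A i)" for v
    by auto
  ultimately show ?thesis
    by (simp only: ball_conj_distrib)
qed

text \<open>By symmetry, "v lies in the closed neighbourhood of p" reads as "p is v or a neighbour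
  of v". The partition thus becomes a condition at each vertex: it has exactly one dominator. All
  later arguments use this form and its open counterpart.\<close>

lemma ECD_set_iff:
  assumes "pair_graph G"
  shows "ECD_set G P \<longleftrightarrow> P \<subseteq> pverts G \<and> (\<forall>v\<in>pverts G. \<exists>!p. p \<in> P \<and> (p = v \<or> (v, p) \<in> parcs G))"
proof (cases "P \<subseteq> pverts G")
  case True
  have "v \<in> closed_nbhd G p \<longleftrightarrow> p = v \<or> (v, p) \<in> parcs G" for v p
    using assms by (auto simp: closed_nbhd_def pair_graph_iff sym_def)
  moreover have "closed_nbhd G p \<subseteq> pverts G" if "p \<in> P" for p
    using assms True that by (auto simp: closed_nbhd_def pair_graph_iff)
  ultimately show ?thesis
    using True indexed_partition_iff[of P "closed_nbhd G" "pverts G"] by (simp add: ECD_set_def)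
qed (simp add: ECD_set_def)

lemma EOD_set_iff:
  assumes "pair_graph G"
  shows "EOD_set G D \<longleftrightarrow> D \<subseteq> pverts G \<and> (\<forall>v\<in>pverts G. \<exists>!d. d \<in> D \<and> (v, d) \<in> parcs G)"
proof (cases "D \<subseteq> pverts G")
  case True
  have "v \<in> open_nbhd G d \<longleftrightarrow> (v, d) \<in> parcs G" for v d
    using assms by (auto simp: pair_graph_iff sym_def)
  moreover have "open_nbhd G d \<subseteq> pverts G" if "d \<in> D" for d
    using assms by (auto simp: pair_graph_iff)
  ultimately show ?thesis
    using True indexed_partition_iff[of D "open_nbhd G" "pverts G"] by (simp add: EOD_set_def)
qed (simp add: EOD_set_def)

section \<open>Trees\<close>

definition delete :: "'a pair_pre_digraph \<Rightarrow> 'a set \<Rightarrow> 'a pair_pre_digraph" where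
  "delete G W = \<lparr>pverts = pverts G - W, parcs = parcs G - (W \<times> UNIV \<union> UNIV \<times> W)\<rparr>"

lemma delete_simps [simp]:
  "pverts (delete G W) = pverts G - W"
  "(u, v) \<in> parcs (delete G W) \<longleftrightarrow> (u, v) \<in> parcs G \<and> u \<notin> W \<and> v \<notin> W"
  by (auto simp: delete_def)

lemma delete_delete: "delete (delete G A) B = delete G (A \<union> B)"
  by (auto simp: delete_def)

lemma pair_graph_delete: "pair_graph G \<Longrightarrow> pair_graph (delete G W)"
  unfolding pair_graph_iff by (auto simp: sym_def irrefl_def)

section \<open>Connectedness, cycles and removal of a leaf\<close>

lemma connected_iff:
  assumes "pair_graph G"
  shows "connected (with_proj G) \<longleftrightarrow> pverts G \<noteq> {} \<and> (\<forall>u\<in>pverts G. \<forall>v\<in>pverts G. (u, v) \<in> (parcs G)\<^sup>*)"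
proof -
  interpret pair_graph G by fact
  show ?thesis
    unfolding connected_def strongly_connected_def
    using reachable_mk_symmetric_eq[OF sym_arcs] reachable_conv'
    by (auto simp: mk_symmetric_def)
qed

lemma cycle_mono:
  assumes "pverts H \<subseteq> pverts G" "parcs H \<subseteq> parcs G" "pre_digraph.cycle (with_proj H) p"
  shows "pre_digraph.cycle (with_proj G) p"
  using assms unfolding pre_digraph.cycle_def pre_digraph.awalk_def
  by (auto simp: cas_with_proj_eq awalk_verts_with_proj_eq)

text \<open>A walk can enter and leave the leaf \<open>v\<close> only through \<open>u\<close>, so
  its visits to \<open>v\<close> can be cut out. The conditional endpoint makes this an invariant of
  the walk: while the walk stands at \<open>v\<close>, the shortened one waits at
  \<open>u\<close>.\<close>

lemma rtrancl_delete_leaf: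
  assumes "sym (parcs G)" "open_nbhd G v = {u}" "(a, b) \<in> (parcs G)\<^sup>*" "a \<noteq> v"
  shows "(a, if b = v then u else b) \<in> (parcs (delete G {v}))\<^sup>*"
  using assms(3)
proof (induction rule: rtrancl_induct)
  case base
  then show ?case using assms by simp
next
  case (step y z)
  have nb: "w = u" if "(v, w) \<in> parcs G \<or> (w, v) \<in> parcs G" for w
    using assms(1,2) that by (auto simp: sym_def set_eq_iff)
  show ?case
  proof (cases "y = v \<or> z = v")
    case True
    with step nb show ?thesis by (auto split: if_splits)
  next
    case False
    with step have "(y, z) \<in> parcs (delete G {v})" by simp
    with step.IH False show ?thesis by (auto intro: rtrancl.rtrancl_into_rtrancl)
  qed
qed

lemma graph_tree_delete_leaf:
  assumes "graph_tree G" "open_nbhd G v = {u}"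
  shows "graph_tree (delete G {v})"
proof -
  have G: "pair_graph G" and con: "connected (with_proj G)"
    and acyc: "\<not> (\<exists>p. pre_digraph.cycle (with_proj G) p \<and> 3 \<le> length p)"
    using assms(1) by (auto simp: graph_tree_def)
  have uv: "(v, u) \<in> parcs G" using assms(2) by (auto simp: set_eq_iff)
  then have "u \<in> pverts G" "u \<noteq> v" using G by (auto simp: pair_graph_iff irrefl_def)
  moreover have "(a, b) \<in> (parcs (delete G {v}))\<^sup>*"
    if "a \<in> pverts G - {v}" "b \<in> pverts G - {v}" for a b
    using rtrancl_delete_leaf[OF _ assms(2), of a b] that con G
    by (auto simp: connected_iff pair_graph_iff)
  ultimately have "connected (with_proj (delete G {v}))"
    using connected_iff[OF pair_graph_delete[OF G]] by auto
  moreover have "\<not> (\<exists>p. pre_digraph.cycle (with_proj (delete G {v})) p \<and> 3 \<le> length p)"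
    using acyc cycle_mono[of "delete G {v}" G] by (auto simp: subset_iff)
  ultimately show ?thesis
    using pair_graph_delete[OF G] by (simp add: graph_tree_def)
qed

section \<open>Paths in a tree and heights of branches\<close>

lemma vwalk_imp_awalk:
  assumes "vwalk q (with_proj G)"
  shows "pre_digraph.awalk (with_proj G) (hd q) (vwalk_arcs q) (last q) \<and> pawalk_verts (hd q) (vwalk_arcs q) = q"
  using assms
proof (induction q rule: induct_list012)
  case (3 x y zs)
  then show ?case
    by (auto simp: vwalk_def pre_digraph.awalk_def cas_with_proj_eq)
qed (auto simp: vwalk_def pre_digraph.awalk_def cas_with_proj_eq)

text \<open>If \<open>d\<close> were already on the path, the part of the path up to it would close
  to a cycle through \<open>d\<close>, \<open>c\<close>, \<open>u\<close>. As \<open>d\<close>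
  differs from \<open>u\<close>, this cycle has at least 3 arcs, which a tree forbids.\<close>

lemma graph_tree_extend_path:
  assumes T: "graph_tree G" and p: "vpath (c # u # p) (with_proj G)"
    and d: "(d, c) \<in> parcs G" "d \<noteq> u"
  shows "vpath (d # c # u # p) (with_proj G)"
proof -
  have G: "pair_graph G" using T by (simp add: graph_tree_def)
  have dc: "d \<noteq> c" "d \<in> pverts G" using G d by (auto simp: pair_graph_iff irrefl_def)
  have "d \<notin> set p"
  proof
    assume "d \<in> set p"
    then obtain r s where rs: "p = r @ d # s" by (meson split_list)
    \<comment> \<open>The closed walk given by its vertices; cycles are lists of arcs, hence the
      passage through \<open>vwalk_arcs\<close>.\<close>
    let ?q = "d # c # u # r @ [d]"
    have "set (vwalk_arcs (c # u # p)) \<subseteq> parcs G"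
      using p by (auto simp: vpath_def vwalk_def)
    then have "set (vwalk_arcs (c # u # r @ [d])) \<subseteq> parcs G"
      using set_vwalk_arcs_append1[of "c # u # r @ [d]" s]
      by (simp add: rs del: vwalk_arcs_Cons vwalk_arcs.simps)
    moreover have "vwalk_arcs ?q = (d, c) # vwalk_arcs (c # u # r @ [d])" by simp
    ultimately have "vwalk ?q (with_proj G)"
      using p d dc unfolding rs vpath_def vwalk_def by (auto simp del: vwalk_arcs_Cons)
    from vwalk_imp_awalk[OF this]
    have "pre_digraph.cycle (with_proj G) (vwalk_arcs ?q)"
      using p dc d unfolding rs vpath_def pre_digraph.cycle_def
      by (intro exI[of _ d]) (auto simp: awalk_verts_with_proj_eq)
    moreover have "3 \<le> length (vwalk_arcs ?q)"
      using vwalk_length_simp[of ?q] by (simp add: vwalk_length_def)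
    ultimately show False using T by (auto simp: graph_tree_def)
  qed
  with p d dc show ?thesis by (auto simp: vpath_def vwalk_def)
qed

text \<open>
  For an edge \<open>uc\<close> of a tree: the component of \<open>G - u\<close> containing \<open>c\<close>, rooted at \<open>c\<close>, has height at
  most \<open>h\<close>.
\<close>

primrec height_le :: "'a pair_pre_digraph \<Rightarrow> nat \<Rightarrow> 'a \<Rightarrow> 'a \<Rightarrow> bool" where
  "height_le G 0 u c \<longleftrightarrow> open_nbhd G c \<subseteq> {u}"
| "height_le G (Suc h) u c \<longleftrightarrow> (\<forall>d\<in>open_nbhd G c - {u}. height_le G h c d)"

text \<open>Failure of the bound \<open>h\<close> allows a descent of \<open>h + 1\<close> levels
  below \<open>c\<close>, each lengthening the path at its front. Together with \<open>c\<close> and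
  \<open>u\<close> this gives the summand \<open>h + 3\<close>.\<close>

lemma not_height_le_path:
  assumes T: "graph_tree G"
  shows "vpath (c # u # p) (with_proj G) \<Longrightarrow> \<not> height_le G h u c \<Longrightarrow>
    \<exists>q. vpath q (with_proj G) \<and> length q = length p + h + 3"
proof (induction h arbitrary: c u p)
  case 0
  then obtain d where "(c, d) \<in> parcs G" "d \<noteq> u" by fastforce
  with graph_tree_extend_path[OF T 0(1)] T
  have "vpath (d # c # u # p) (with_proj G)"
    by (auto simp: graph_tree_def pair_graph_iff sym_def)
  then show ?case by (intro exI[of _ "d # c # u # p"]) simp
next
  case (Suc h)
  then obtain d where d: "(c, d) \<in> parcs G" "d \<noteq> u" "\<not> height_le G h c d" by fastforce
  with graph_tree_extend_path[OF T Suc(2)] T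
  have "vpath (d # c # u # p) (with_proj G)"
    by (auto simp: graph_tree_def pair_graph_iff sym_def)
  from Suc.IH[OF this d(3)] show ?case by simp
qed

text \<open>Otherwise there would be a path with more vertices than the graph. This provides a
  finite bound from which the induction on heights can start.\<close>

lemma height_le_card:
  assumes T: "graph_tree G" and uc: "(u, c) \<in> parcs G"
  shows "height_le G (card (pverts G)) u c"
proof (rule ccontr)
  assume *: "\<not> ?thesis"
  have G: "pair_graph G" using T by (simp add: graph_tree_def)
  with uc have "vpath [c, u] (with_proj G)"
    by (auto simp: vpath_def vwalk_def pair_graph_iff sym_def irrefl_def)
  from not_height_le_path[OF T this *] obtain q where
    q: "vpath q (with_proj G)" "length q = card (pverts G) + 3" by auto
  then have "length q \<le> card (pverts G)"
    using card_mono[of "pverts G" "set q"] G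
    by (auto simp: vpath_def vwalk_def pair_graph_iff distinct_card)
  with q show False by simp
qed

text \<open>Descending from child to child must stop, and it stops at a leaf.\<close>

lemma height_le_imp_leaf:
  assumes "sym (parcs G)"
  shows "height_le G h u c \<Longrightarrow> (u, c) \<in> parcs G \<Longrightarrow> \<exists>r s. open_nbhd G r = {s}"
proof (induction h arbitrary: u c)
  case 0
  then have "open_nbhd G c = {u}" using assms by (auto simp: sym_def)
  then show ?case by blast
next
  case (Suc h)
  have "u \<in> open_nbhd G c" using Suc.prems assms by (auto simp: sym_def)
  show ?case
  proof (cases "open_nbhd G c = {u}")
    case False
    with \<open>u \<in> open_nbhd G c\<close> obtain d where "(c, d) \<in> parcs G" "d \<noteq> u" by fastforce
    with Suc.prems Suc.IH[of c d] show ?thesis by simp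
  qed blast
qed

section \<open>Deleting and adding vertices\<close>

lemma degree_eq_card: "degree G v = card (open_nbhd G v)"
proof -
  have "out_arcs (with_proj G) v = Pair v ` open_nbhd G v"
    by (auto simp: out_arcs_def image_iff)
  then show ?thesis by (simp add: out_degree_def card_image inj_on_def)
qed

lemma open_nbhd_delete: "x \<notin> W \<Longrightarrow> open_nbhd (delete G W) x = open_nbhd G x - W"
  by auto

lemma extend_simps [simp]:
  "pverts (extend G W E) = pverts G \<union> W"
  "parcs (extend G W E) = parcs G \<union> E \<union> E\<inverse>"
  by (simp_all add: extend_def)

text \<open>The last assumption says that \<open>E\<close>, read without direction, contains every
  edge touching \<open>W\<close>. The lemma then presents a tree as the result of an operation on
  its deletion.\<close>

lemma extend_delete_eq:
  assumes "pair_graph G" "W \<subseteq> pverts G" "E \<subseteq> parcs G"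
    and "\<forall>a\<in>W. \<forall>b\<in>open_nbhd G a. (a, b) \<in> E \<union> E\<inverse>"
  shows "G = extend (delete G W) W E"
proof -
  have arcs: "parcs G = parcs (delete G W) \<union> E \<union> E\<inverse>"
  proof (intro equalityI subrelI)
    fix a b assume ab: "(a, b) \<in> parcs G"
    then have "(b, a) \<in> parcs G" using assms(1) by (auto simp: pair_graph_iff dest: symD)
    then show "(a, b) \<in> parcs (delete G W) \<union> E \<union> E\<inverse>"
      using assms(4)[rule_format, of a b] assms(4)[rule_format, of b a] ab by auto
  next
    fix a b assume "(a, b) \<in> parcs (delete G W) \<union> E \<union> E\<inverse>"
    then show "(a, b) \<in> parcs G" using assms(1,3) by (auto simp: pair_graph_iff dest: symD)
  qed
  have "pverts G = pverts (extend (delete G W) W E)"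
    using assms(2) by auto
  moreover have "parcs G = parcs (extend (delete G W) W E)"
    unfolding extend_simps by (rule arcs)
  ultimately show ?thesis by (intro pair_pre_digraph.equality) simp_all
qed

text \<open>A removed vertex with a remaining neighbour is not in \<open>D\<close>, so every
  remaining vertex keeps its dominator and no other arises.\<close>

lemma EOD_set_delete:
  assumes "pair_graph G" "EOD_set G D"
    and "\<And>a b. (a, b) \<in> parcs G \<Longrightarrow> a \<notin> W \<Longrightarrow> b \<in> W \<Longrightarrow> b \<notin> D"
  shows "EOD_set (delete G W) (D - W)"
proof -
  have "d \<in> D - W \<and> (v, d) \<in> parcs (delete G W) \<longleftrightarrow> d \<in> D \<and> (v, d) \<in> parcs G"
    if "v \<in> pverts (delete G W)" for v d
    using assms(3) that by auto
  with assms(2) show ?thesis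
    unfolding EOD_set_iff[OF assms(1)] EOD_set_iff[OF pair_graph_delete[OF assms(1)]]
    by auto
qed

lemma ECD_set_delete:
  assumes "pair_graph G" "ECD_set G P"
    and "\<And>a b. (a, b) \<in> parcs G \<Longrightarrow> a \<notin> W \<Longrightarrow> b \<in> W \<Longrightarrow> b \<notin> P"
  shows "ECD_set (delete G W) (P - W)"
proof -
  have "p \<in> P - W \<and> (p = v \<or> (v, p) \<in> parcs (delete G W)) \<longleftrightarrow> p \<in> P \<and> (p = v \<or> (v, p) \<in> parcs G)"
    if "v \<in> pverts (delete G W)" for v p
    using assms(3) that by auto
  with assms(2) show ?thesis
    unfolding ECD_set_iff[OF assms(1)] ECD_set_iff[OF pair_graph_delete[OF assms(1)]]
    by auto
qed

section \<open>Local consequences of a fixed EOD set and ECD set\<close>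

locale eocd_sets =
  fixes T :: "'a pair_pre_digraph" and D P :: "'a set"
  assumes pair: "pair_graph T" and EOD: "EOD_set T D" and ECD: "ECD_set T P"
begin

lemma arc_sym: "(u, v) \<in> parcs T \<Longrightarrow> (v, u) \<in> parcs T"
  and arc_irrefl [simp]: "(u, u) \<notin> parcs T"
  and arc_verts: "(u, v) \<in> parcs T \<Longrightarrow> u \<in> pverts T \<and> v \<in> pverts T"
  using pair by (auto simp: pair_graph_iff sym_def irrefl_def)

lemma D_verts: "d \<in> D \<Longrightarrow> d \<in> pverts T"
  and D_ex: "v \<in> pverts T \<Longrightarrow> \<exists>d\<in>D. (v, d) \<in> parcs T"
  and D_unique: "d \<in> D \<Longrightarrow> d' \<in> D \<Longrightarrow> (v, d) \<in> parcs T \<Longrightarrow> (v, d') \<in> parcs T \<Longrightarrow> d = d'"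
  using EOD arc_verts unfolding EOD_set_iff[OF pair] by blast+

lemma P_ex1: "v \<in> pverts T \<Longrightarrow> \<exists>!p. p \<in> P \<and> (p = v \<or> (v, p) \<in> parcs T)"
  using ECD unfolding ECD_set_iff[OF pair] by blast

lemma P_verts: "p \<in> P \<Longrightarrow> p \<in> pverts T"
  and P_ex: "v \<in> pverts T \<Longrightarrow> \<exists>p\<in>P. p = v \<or> (v, p) \<in> parcs T"
  and P_indep: "p \<in> P \<Longrightarrow> q \<in> P \<Longrightarrow> (p, q) \<notin> parcs T"
  and P_unique: "p \<in> P \<Longrightarrow> q \<in> P \<Longrightarrow> (v, p) \<in> parcs T \<Longrightarrow> (v, q) \<in> parcs T \<Longrightarrow> p = q"
  using ECD arc_verts arc_irrefl unfolding ECD_set_iff[OF pair] by (blast+)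

text \<open>Once a neighbourhood is known, questions about arcs at its vertex become finite case
  checks. The proofs below collect these rewritings under the name \<open>A\<close>.\<close>

lemma nbhd_arc: "open_nbhd T c = X \<Longrightarrow> (c, w) \<in> parcs T \<longleftrightarrow> w \<in> X"
  by auto

lemma nbhd_verts: "open_nbhd T c = insert w X \<Longrightarrow> c \<in> pverts T \<and> w \<in> pverts T \<and> X \<subseteq> pverts T"
  using arc_verts[of c] by (auto simp: set_eq_iff)

lemma nbhd_arc': "open_nbhd T c = X \<Longrightarrow> (w, c) \<in> parcs T \<longleftrightarrow> w \<in> X"
  using arc_sym by auto

end

section \<open>Irreducible trees\<close>

locale irreducible = eocd_sets +
  assumes tree: "graph_tree T"
    and irred: "\<And>T'. graph_tree T' \<Longrightarrow> EOCD_graph T' \<Longrightarrow> EOCD_step T' T \<Longrightarrow> False"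
begin

text \<open>The common end of all reductions. The sets of the smaller tree are arbitrary, since for
  \<open>O\<^sub>4\<close> and \<open>O\<^sub>5\<close> its ECD set is not a restriction of
  \<open>P\<close>.\<close>

lemma step_False:
  assumes "graph_tree (delete T W)" "EOD_set (delete T W) D'" "ECD_set (delete T W) P'"
    and "op_O1 (delete T W) D' P' T \<or> op_O2 (delete T W) D' P' T \<or> op_O3 (delete T W) D' P' T
      \<or> op_O4 (delete T W) D' P' T \<or> op_O5 (delete T W) D' P' T"
  shows False
  using irred[of "delete T W"] assms pair_graph_delete[OF pair]
  by (auto simp: EOCD_graph_def EOCD_step_def)

section \<open>Configurations excluded by irreducibility\<close>

lemma support_in_D: "open_nbhd T a = {c} \<Longrightarrow> c \<in> D"
  using D_ex[of a] arc_verts by fastforce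

text \<open>A leaf outside both sets can be deleted without harm to either. Its neighbour then lies
  in both sets, being its only possible dominator, so \<open>O\<^sub>1\<close> restores the
  leaf.\<close>

lemma leaf_in_D_or_P:
  assumes a: "open_nbhd T a = {c}"
  shows "a \<in> D \<or> a \<in> P"
proof (rule ccontr)
  assume n: "\<not> ?thesis"
  note A = nbhd_arc[OF a] nbhd_arc'[OF a]
  have ca: "c \<noteq> a" using A(1)[of a] by auto
  have V: "a \<in> pverts T" using A(1)[of c] arc_verts by simp
  have "c \<in> P" using P_ex[OF V] n A by auto
  have "EOD_set (delete T {a}) (D - {a})"
    by (rule EOD_set_delete[OF pair EOD]) (use n in auto)
  moreover have "ECD_set (delete T {a}) (P - {a})"
    by (rule ECD_set_delete[OF pair ECD]) (use n in auto)
  moreover have "T = extend (delete T {a}) {a} {(c, a)}"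
    by (rule extend_delete_eq[OF pair]) (simp_all add: A V a)
  then have "op_O1 (delete T {a}) (D - {a}) (P - {a}) T"
    using \<open>c \<in> P\<close> support_in_D[OF a] ca by (auto simp: op_O1_def)
  ultimately show False
    using step_False[OF graph_tree_delete_leaf[OF tree a]] by blast
qed

text \<open>Of two leaves at \<open>c\<close>, at most one is in \<open>D\<close> and at most one in
  \<open>P\<close>, so one is in \<open>D\<close> only and the other in \<open>P\<close> only. The
  former needs \<open>c\<close> in \<open>P\<close> as its dominator, but \<open>c\<close> is
  adjacent to the latter.\<close>

lemma no_twin_leaves:
  assumes "open_nbhd T a = {c}" "open_nbhd T b = {c}"
  shows "a = b"
proof -
  note A = nbhd_arc[OF assms(1)] nbhd_arc[OF assms(2)] nbhd_arc'[OF assms(1)] nbhd_arc'[OF assms(2)]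
  have V: "a \<in> pverts T" "b \<in> pverts T" using nbhd_verts[OF assms(1)] nbhd_verts[OF assms(2)] by simp_all
  show ?thesis
    using P_ex[OF V(1)] P_ex[OF V(2)] leaf_in_D_or_P[OF assms(1)] leaf_in_D_or_P[OF assms(2)]
      P_unique[of a b c] D_unique[of a b c] P_indep[of a c] P_indep[of b c] A
    by auto
qed

text \<open>The pendant path \<open>x\<close>, \<open>u\<close>, \<open>v\<close> meets the rest
  only through \<open>x\<close>, which lies in neither set, so it can be cut off; \<open>w\<close>
  is not in \<open>D\<close> because \<open>u\<close> is the \<open>D\<close>-neighbour of
  \<open>x\<close>.\<close>

lemma no_O2:
  assumes v: "open_nbhd T v = {u}" and u: "open_nbhd T u = {v, x}" and x: "open_nbhd T x = {u, w}"
    and ne: "v \<noteq> x" "u \<noteq> w" and D: "u \<in> D" "v \<in> D"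
  shows False
proof -
  note A = nbhd_arc[OF v] nbhd_arc[OF u] nbhd_arc[OF x]
    nbhd_arc'[OF v] nbhd_arc'[OF u] nbhd_arc'[OF x]
  have ne': "u \<noteq> v" "u \<noteq> x" "w \<noteq> x" "w \<noteq> v" using A(2)[of u] A(2)[of x] A(3)[of x] A(1)[of x] A(3)[of w] A(3)[of v] nbhd_arc'[OF v, of x] ne by auto
  have V: "v \<in> pverts T" "u \<in> pverts T" "x \<in> pverts T" "w \<in> pverts T" using nbhd_verts[OF v] nbhd_verts[OF u] nbhd_verts[OF x] by simp_all
  have "x \<notin> D" "w \<notin> D"
    using D_unique[of v x u] D_unique[of u w x] D A ne by auto
  have "x \<notin> P"
    using P_ex[OF V(1)] P_indep[of x u] P_unique[of x v u] A ne by auto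
  \<comment> \<open>Written as a union of singletons so that the path is removed leaf by leaf from
    its end, the tree property surviving each time.\<close>
  let ?W = "{v} \<union> {u} \<union> {x}"
  have "graph_tree (delete T ?W)"
    unfolding delete_delete[symmetric]
    using v u x ne ne' by (intro graph_tree_delete_leaf tree) (auto simp: open_nbhd_delete)
  moreover have "EOD_set (delete T ?W) (D - ?W)"
    by (rule EOD_set_delete[OF pair EOD]) (use A \<open>x \<notin> D\<close> in auto)
  moreover have "ECD_set (delete T ?W) (P - ?W)"
    by (rule ECD_set_delete[OF pair ECD]) (use A \<open>x \<notin> P\<close> in auto)
  moreover have eq: "T = extend (delete T ?W) {x, u, v} {(x, u), (u, v), (w, x)}"
  proof -
    have "T = extend (delete T ?W) ?W {(x, u), (u, v), (w, x)}"
      by (rule extend_delete_eq[OF pair]) (simp_all add: A V v u x)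
    then show ?thesis by (simp add: insert_commute)
  qed
  \<comment> \<open>Stated exactly as the conjuncts of \<open>op_O2_def\<close>, so that matching
    them by assumption finds the witnesses.\<close>
  have "w \<in> pverts (delete T ?W)" "w \<notin> D - ?W" "distinct [x, u, v]" "{x, u, v} \<inter> pverts (delete T ?W) = {}"
    using V ne ne' \<open>w \<notin> D\<close> by auto
  with eq have "op_O2 (delete T ?W) (D - ?W) (P - ?W) T"
    unfolding op_O2_def by (intro exI conjI) assumption+
  ultimately show False
    using step_False by blast
qed

text \<open>Here \<open>z\<close> is the only link to the rest and lies in neither set. Its
  dominator in \<open>D\<close> must be \<open>t\<close>, as \<open>w\<close> is not in
  \<open>D\<close>, and its dominator in \<open>P\<close> is \<open>w\<close>; hence
  \<open>t\<close> is in \<open>D - P\<close>, as \<open>O\<^sub>3\<close> demands.\<close>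

lemma no_O3:
  assumes v: "open_nbhd T v = {u}" and u: "open_nbhd T u = {v, x}" and x: "open_nbhd T x = {u, w}"
    and w: "open_nbhd T w = {x, z}" and z: "open_nbhd T z = {w, t}"
    and ne: "v \<noteq> x" "u \<noteq> w" "x \<noteq> z" "w \<noteq> t" and D: "u \<in> D" "x \<in> D" and P: "v \<in> P" "w \<in> P"
  shows False
proof -
  note A = nbhd_arc[OF v] nbhd_arc[OF u] nbhd_arc[OF x] nbhd_arc[OF w] nbhd_arc[OF z]
    nbhd_arc'[OF v] nbhd_arc'[OF u] nbhd_arc'[OF x] nbhd_arc'[OF w] nbhd_arc'[OF z]
  have V: "v \<in> pverts T" "u \<in> pverts T" "x \<in> pverts T" "w \<in> pverts T" "z \<in> pverts T" "t \<in> pverts T"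
    using nbhd_verts[OF v] nbhd_verts[OF u] nbhd_verts[OF x] nbhd_verts[OF w] nbhd_verts[OF z] by simp_all
  have "v \<notin> D" "w \<notin> D" "z \<notin> D"
    using D_unique[of v x u] D_unique[of u w x] D_unique[of x z w] D A ne by auto
  have "u \<notin> P" "x \<notin> P" "z \<notin> P" "t \<notin> P"
    using P_indep[of u v] P_indep[of x w] P_indep[of z w] P_unique[of w t z] P A ne by auto
  have "t \<in> D" using D_ex[OF V(5)] A \<open>w \<notin> D\<close> by auto
  have dist: "distinct [z, w, x, u, v, t]"
    using D P \<open>t \<in> D\<close> \<open>v \<notin> D\<close> \<open>w \<notin> D\<close> \<open>z \<notin> D\<close> \<open>u \<notin> P\<close> \<open>x \<notin> P\<close> \<open>z \<notin> P\<close> \<open>t \<notin> P\<close> ne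
      A(1)[of x] A(2)[of z] A(3)[of z] A(4)[of x] A(5)[of t] A(2)[of x]
        nbhd_arc'[OF u, of z] nbhd_arc'[OF x, of z] by auto
  let ?W = "{v} \<union> {u} \<union> {x} \<union> {w} \<union> {z}"
  have "graph_tree (delete T ?W)"
    unfolding delete_delete[symmetric]
    using v u x w z dist by (intro graph_tree_delete_leaf tree) (auto simp: open_nbhd_delete)
  moreover have "EOD_set (delete T ?W) (D - ?W)"
    by (rule EOD_set_delete[OF pair EOD]) (use A \<open>z \<notin> D\<close> \<open>w \<notin> D\<close> in auto)
  moreover have "ECD_set (delete T ?W) (P - ?W)"
    by (rule ECD_set_delete[OF pair ECD]) (use A \<open>x \<notin> P\<close> \<open>z \<notin> P\<close> in auto)
  moreover have eq: "T = extend (delete T ?W) {z, w, x, u, v} {(z, w), (w, x), (x, u), (u, v), (t, z)}"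
  proof -
    have "T = extend (delete T ?W) ?W {(z, w), (w, x), (x, u), (u, v), (t, z)}"
      by (rule extend_delete_eq[OF pair]) (simp_all add: A V v u x w z)
    then show ?thesis by (simp add: insert_commute)
  qed
  have "t \<in> (D - ?W) - (P - ?W)" "distinct [z, w, x, u, v]" "{z, w, x, u, v} \<inter> pverts (delete T ?W) = {}"
    using dist \<open>t \<in> D\<close> \<open>t \<notin> P\<close> by auto
  with eq have "op_O3 (delete T ?W) (D - ?W) (P - ?W) T"
    unfolding op_O3_def by (intro exI conjI) assumption+
  ultimately show False
    using step_False by blast
qed

lemma no_O4:
  assumes v: "open_nbhd T v = {u}" and u: "open_nbhd T u = {v, x}" and y: "open_nbhd T y = {x}"
    and D: "u \<in> D" "x \<in> D" and P: "v \<in> P" "y \<in> P"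
  shows False
proof -
  note A = nbhd_arc[OF v] nbhd_arc[OF u] nbhd_arc[OF y]
    nbhd_arc'[OF v] nbhd_arc'[OF u] nbhd_arc'[OF y]
  have V: "v \<in> pverts T" "u \<in> pverts T" "x \<in> pverts T" "y \<in> pverts T" using nbhd_verts[OF v] nbhd_verts[OF u] nbhd_verts[OF y] by simp_all
  have nP: "u \<notin> P" "x \<notin> P" using P_indep[of u v] P_indep[of x y] P A by auto
  have nD: "v \<notin> D" "y \<notin> D"
    using D_unique[of v x u] D_unique[of y u x] D P nP A by auto
  have ne: "distinct [v, u, x, y]"
    using D P nP nD A(1)[of x] A(2)[of x] A(3)[of x] by auto
  \<comment> \<open>Without \<open>y\<close>, the vertex \<open>x\<close> loses its dominator.
    Moving \<open>v\<close> to \<open>u\<close> repairs this: \<open>u\<close> alone dominates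
    \<open>v\<close>, \<open>u\<close> and \<open>x\<close>.\<close>
  let ?T = "delete T {y}" and ?P = "insert u (P - {v, y})"
  have "graph_tree ?T" by (rule graph_tree_delete_leaf[OF tree y])
  have "EOD_set ?T (D - {y})"
    by (rule EOD_set_delete[OF pair EOD]) (use nD in auto)
  have "ECD_set ?T ?P"
    unfolding ECD_set_iff[OF pair_graph_delete[OF pair]]
  proof (intro conjI ballI)
    show "?P \<subseteq> pverts ?T" using P_verts V ne by auto
    fix c assume c: "c \<in> pverts ?T"
    show "\<exists>!p. p \<in> ?P \<and> (p = c \<or> (c, p) \<in> parcs ?T)"
    proof (cases "c \<in> {v, u, x}")
      case True
      \<comment> \<open>Rules out a second dominator of \<open>x\<close> in the new set.\<close>
      have "p = y" if "p \<in> P" "(x, p) \<in> parcs T" for p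
        using P_unique[OF that(1) P(2) that(2)] A by simp
      with True show ?thesis
        using A ne nP by (intro ex1I[of _ u]) auto
    next
      case False
      have "p \<in> ?P \<and> (p = c \<or> (c, p) \<in> parcs ?T) \<longleftrightarrow> p \<in> P \<and> (p = c \<or> (c, p) \<in> parcs T)" for p
        using A False c by auto
      then show ?thesis using P_ex1[of c] c by simp
    qed
  qed
  have eq: "T = extend ?T {y} {(y, x)}"
    by (rule extend_delete_eq[OF pair]) (simp_all add: A V y)
  have vp: "vpath [v, u, x] (with_proj ?T)"
    using V A ne by (auto simp: vpath_def vwalk_def)
  have deg: "degree ?T v = 1" "degree ?T u = 2"
    using v u ne by (auto simp: degree_eq_card open_nbhd_delete)
  have "u \<in> D - {y}" "x \<in> D - {y}" "u \<in> ?P" "y \<notin> pverts ?T"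
    using D ne by auto
  with eq vp deg have "op_O4 ?T (D - {y}) ?P T"
    unfolding op_O4_def by (intro exI conjI) assumption+
  with \<open>graph_tree ?T\<close> \<open>EOD_set ?T (D - {y})\<close> \<open>ECD_set ?T ?P\<close> show False
    using step_False by blast
qed

lemma no_O5:
  assumes v: "open_nbhd T v = {u}" and u: "open_nbhd T u = {v, x}" and x: "open_nbhd T x = {u, w}"
    and w: "open_nbhd T w = {x, z}" and w': "open_nbhd T w' = {z, x'}" and x': "open_nbhd T x' = {w'}"
    and D: "u \<in> D" "x \<in> D" "w' \<in> D" "x' \<in> D" and P: "v \<in> P" "w \<in> P" "x' \<in> P"
    and ne: "u \<noteq> w" "x \<noteq> z"
  shows False
proof -
  note A = nbhd_arc[OF v] nbhd_arc[OF u] nbhd_arc[OF x] nbhd_arc[OF w] nbhd_arc[OF w'] nbhd_arc[OF x']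
    nbhd_arc'[OF v] nbhd_arc'[OF u] nbhd_arc'[OF x] nbhd_arc'[OF w] nbhd_arc'[OF w'] nbhd_arc'[OF x']
  have V: "v \<in> pverts T" "u \<in> pverts T" "x \<in> pverts T" "w \<in> pverts T" "z \<in> pverts T"
    "w' \<in> pverts T" "x' \<in> pverts T"
    using nbhd_verts[OF v] nbhd_verts[OF u] nbhd_verts[OF x] nbhd_verts[OF w] nbhd_verts[OF w'] nbhd_verts[OF x'] by simp_all
  have nP: "u \<notin> P" "x \<notin> P" "z \<notin> P" "w' \<notin> P"
    using P_indep[of u v] P_indep[of x w] P_indep[of z w] P_indep[of w' x'] P A by auto
  have nD: "v \<notin> D" "w \<notin> D" "z \<notin> D"
    using D_unique[of v x u] D_unique[of u w x] D_unique[of x z w] D P nP A ne by auto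
  have dist: "distinct [v, u, x, w, z, w', x']"
    using D P nP nD A(1)[of x] A(4)[of x] A(2)[of x] A(5)[of z] A(2)[of z] A(3)[of z] by auto
  \<comment> \<open>The ECD set is shifted along the path. Before, \<open>v\<close> served
    \<open>v\<close>, \<open>u\<close>, then \<open>w\<close> served \<open>x\<close>,
    \<open>w\<close>, \<open>z\<close>, and \<open>x'\<close> served \<open>w'\<close>,
    \<open>x'\<close>; now \<open>x\<close> serves \<open>u\<close>, \<open>x\<close>,
    \<open>w\<close>, and \<open>w'\<close> serves \<open>z\<close>, \<open>w'\<close>,
    \<open>x'\<close>.\<close>
  let ?T = "delete T {v}" and ?P = "{x, w'} \<union> (P - {v, w, x'})"
  have "graph_tree ?T" by (rule graph_tree_delete_leaf[OF tree v])
  have "EOD_set ?T (D - {v})"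
    by (rule EOD_set_delete[OF pair EOD]) (use nD in auto)
  have "ECD_set ?T ?P"
    unfolding ECD_set_iff[OF pair_graph_delete[OF pair]]
  proof (intro conjI ballI)
    show "?P \<subseteq> pverts ?T" using P_verts V dist by auto
    fix c assume c: "c \<in> pverts ?T"
    show "\<exists>!p. p \<in> ?P \<and> (p = c \<or> (c, p) \<in> parcs ?T)"
    proof (cases "c \<in> {u, x, w}")
      case True
      then show ?thesis
        using A P dist nP by (intro ex1I[of _ x]) auto
    next
      case F1: False
      show ?thesis
      proof (cases "c \<in> {z, w', x'}")
        case True
        have "p = w" if "p \<in> P" "(z, p) \<in> parcs T" for p
          using P_unique[OF that(1) P(2) that(2)] A by simp
        with True show ?thesis
          using A dist nP by (intro ex1I[of _ w']) auto
      next
        case False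
        have "p \<in> ?P \<and> (p = c \<or> (c, p) \<in> parcs ?T) \<longleftrightarrow> p \<in> P \<and> (p = c \<or> (c, p) \<in> parcs T)" for p
          using A F1 False c by auto
        then show ?thesis using P_ex1[of c] c by simp
      qed
    qed
  qed
  have eq: "T = extend ?T {v} {(u, v)}"
    by (rule extend_delete_eq[OF pair]) (simp_all add: A V v)
  have vp: "vpath [u, x, w, z, w', x'] (with_proj ?T)"
    using V A dist by (auto simp: vpath_def vwalk_def)
  have deg: "degree ?T u = 1" "degree ?T x' = 1" "degree ?T x = 2" "degree ?T w = 2" "degree ?T w' = 2"
    using u x w w' x' dist by (auto simp: degree_eq_card open_nbhd_delete)
  have "u \<in> D - {v}" "x \<in> D - {v}" "w' \<in> D - {v}" "x' \<in> D - {v}" "x \<in> ?P" "w' \<in> ?P" "v \<notin> pverts ?T"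
    using D dist by auto
  with eq vp deg have "op_O5 ?T (D - {v}) ?P T"
    unfolding op_O5_def by (intro exI conjI) assumption+
  with \<open>graph_tree ?T\<close> \<open>EOD_set ?T (D - {v})\<close> \<open>ECD_set ?T ?P\<close> show False
    using step_False by blast
qed

section \<open>Shape of the branches of an irreducible tree, by height\<close>

lemma height0: "(u, c) \<in> parcs T \<Longrightarrow> height_le T 0 u c \<Longrightarrow> open_nbhd T c = {u}"
  using arc_sym by auto

lemma nbhd_pairI:
  assumes "(u, c) \<in> parcs T" "(c, b) \<in> parcs T" "\<And>d. (c, d) \<in> parcs T \<Longrightarrow> d \<noteq> u \<Longrightarrow> d = b"
  shows "open_nbhd T c = {u, b}"
  using assms(2,3) arc_sym[OF assms(1)] by auto

lemma height_child:
  assumes "height_le T (Suc h) u c" "(c, d) \<in> parcs T" "d \<noteq> u"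
  shows "height_le T h c d"
  using assms by auto

lemma not_height_child:
  assumes "\<not> height_le T (Suc h) u c"
  obtains d where "(c, d) \<in> parcs T" "d \<noteq> u" "\<not> height_le T h c d"
  using assms by fastforce

lemma height1:
  assumes uc: "(u, c) \<in> parcs T" and "height_le T 1 u c" and "\<not> height_le T 0 u c"
  shows "\<exists>a. u \<noteq> a \<and> open_nbhd T c = {u, a} \<and> open_nbhd T a = {c}"
proof -
  from assms(3) obtain a where a: "(c, a) \<in> parcs T" "a \<noteq> u" by fastforce
  have *: "open_nbhd T d = {c}" if "(c, d) \<in> parcs T" "d \<noteq> u" for d
    using height0[OF that(1)] height_child[of 0 u c d] that assms(2) by simp
  have "open_nbhd T c = {u, a}"
    by (rule nbhd_pairI[OF uc a(1)]) (rule no_twin_leaves[OF * *[OF a]])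
  moreover have "u \<noteq> a" using a(2) by blast
  ultimately show ?thesis using *[OF a] by (intro exI conjI) assumption+
qed

lemma height2:
  assumes uc: "(u, c) \<in> parcs T" and "height_le T 2 u c" and "\<not> height_le T 1 u c"
  shows "\<exists>b a. u \<noteq> b \<and> c \<noteq> a \<and> open_nbhd T c = {u, b}
    \<and> open_nbhd T b = {c, a} \<and> open_nbhd T a = {b}
    \<and> a \<in> P \<and> b \<in> D \<and> c \<in> D \<and> u \<in> P"
proof -
  from assms(3) obtain b where b: "(c, b) \<in> parcs T" "b \<noteq> u" "\<not> height_le T 0 c b"
    using not_height_child[of 0 u c] by auto
  have kid: "height_le T 1 c d" if "(c, d) \<in> parcs T" "d \<noteq> u" for d
    using height_child[of 1 u c d] assms(2) that by (simp add: numeral_2_eq_2)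
  from height1[OF b(1) kid[OF b(1,2)] b(3)] obtain a
    where a: "c \<noteq> a" "open_nbhd T b = {c, a}" "open_nbhd T a = {b}" by blast
  have bD: "b \<in> D" by (rule support_in_D[OF a(3)])
  \<comment> \<open>A second non-leaf child would, like \<open>b\<close>, be the neighbour of a leaf
    and so in \<open>D\<close>; but \<open>c\<close> has only one neighbour in
    \<open>D\<close>.\<close>
  have other: "open_nbhd T d = {c}" if d: "(c, d) \<in> parcs T" "d \<noteq> u" "d \<noteq> b" for d
  proof (rule ccontr)
    assume "open_nbhd T d \<noteq> {c}"
    then have "\<not> height_le T 0 c d" using height0[OF d(1)] by blast
    from height1[OF d(1) kid[OF d(1,2)] this] obtain a' where "open_nbhd T a' = {d}" by blast
    then have "d \<in> D" by (rule support_in_D)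
    with bD b d show False using D_unique[of d b c] by blast
  qed
  \<comment> \<open>Otherwise \<open>c\<close> supports no leaf, so \<open>b\<close> is its only
    child, and \<open>b\<close> must have its leaf \<open>a\<close> as \<open>D\<close>-neighbour:
    the situation of \<open>O\<^sub>2\<close>.\<close>
  have "c \<in> D"
  proof (rule ccontr)
    assume "c \<notin> D"
    then have aD: "a \<in> D" using D_ex[of b] nbhd_verts[OF a(2)] nbhd_arc[OF a(2)] by auto
    have "open_nbhd T c = {u, b}"
      using nbhd_pairI[OF uc b(1)] other support_in_D[of _ c] \<open>c \<notin> D\<close> by blast
    then have "open_nbhd T c = {b, u}" by auto
    moreover have "open_nbhd T b = {a, c}" using a(2) by auto
    ultimately show False using no_O2[OF a(3), of c u] a(1) b(2) bD aD by blast
  qed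
  then have "a \<notin> D" using D_unique[of a c b] a(1) nbhd_arc[OF a(2)] bD by auto
  then have aP: "a \<in> P" using leaf_in_D_or_P[OF a(3)] by blast
  have "c \<notin> P" using P_unique[of a c b] a(1) nbhd_arc[OF a(2)] aP by auto
  have "b \<notin> P" using P_indep[of a b] nbhd_arc[OF a(3)] aP by auto
  have b2: "open_nbhd T b = {a, c}" using a(2) by auto
  \<comment> \<open>A leaf at \<open>c\<close> is not in \<open>D\<close>, because \<open>b\<close>
    is already the \<open>D\<close>-neighbour of \<open>c\<close>; hence it is in \<open>P\<close>
    and \<open>O\<^sub>4\<close> applies.\<close>
  have no_leaf: "open_nbhd T d \<noteq> {c}" if "d \<noteq> b" for d
  proof
    assume d: "open_nbhd T d = {c}"
    then have "(c, d) \<in> parcs T" using nbhd_arc'[OF d] by auto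
    then have "d \<notin> D" using D_unique[OF _ bD _ b(1)] that by blast
    then have "d \<in> P" using leaf_in_D_or_P[OF d] by blast
    then show False using no_O4[OF a(3) b2 d bD \<open>c \<in> D\<close> aP] by blast
  qed
  then have c: "open_nbhd T c = {u, b}" using nbhd_pairI[OF uc b(1)] other by blast
  then have "u \<in> P" using P_ex[of c] nbhd_verts[OF c] nbhd_arc[OF c] \<open>c \<notin> P\<close> \<open>b \<notin> P\<close> by auto
  moreover have "u \<noteq> b" using b(2) by blast
  ultimately show ?thesis using a c bD aP \<open>c \<in> D\<close> by (intro exI conjI) assumption+
qed

text \<open>The child \<open>b\<close> of height 2 puts \<open>c\<close> into \<open>P\<close>, and
  \<open>c\<close> is not in \<open>D\<close> because \<open>d\<close> is the
  \<open>D\<close>-neighbour of \<open>b\<close>. A second child is then no leaf, so its height is 1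
  or 2 and it lies in \<open>D\<close>, which conflicts with \<open>b\<close>.\<close>

lemma height3:
  assumes vc: "(v, c) \<in> parcs T" and "height_le T 3 v c" and "\<not> height_le T 2 v c"
  shows "\<exists>b d a. v \<noteq> b \<and> c \<noteq> d \<and> b \<noteq> a \<and> open_nbhd T c = {v, b}
    \<and> open_nbhd T b = {c, d} \<and> open_nbhd T d = {b, a} \<and> open_nbhd T a = {d}
    \<and> a \<in> P \<and> d \<in> D \<and> b \<in> D \<and> c \<in> P \<and> c \<notin> D"
proof -
  from assms(3) obtain b where b: "(c, b) \<in> parcs T" "b \<noteq> v" "\<not> height_le T 1 c b"
    using not_height_child[of 1 v c] by (auto simp: numeral_2_eq_2)
  have kid: "height_le T 2 c d" if "(c, d) \<in> parcs T" "d \<noteq> v" for d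
    using height_child[of 2 v c d] assms(2) that by (simp add: numeral_3_eq_3 numeral_2_eq_2)
  from height2[OF b(1) kid[OF b(1,2)] b(3)] obtain d a
    where d: "c \<noteq> d" "b \<noteq> a" "open_nbhd T b = {c, d}" "open_nbhd T d = {b, a}" "open_nbhd T a = {d}"
      "a \<in> P" "d \<in> D" "b \<in> D" "c \<in> P" by blast
  have "c \<notin> D" using D_unique[of c d b] d nbhd_arc[OF d(3)] by auto
  have "x = b" if x: "(c, x) \<in> parcs T" and xv: "x \<noteq> v" for x
  proof (rule ccontr)
    assume xb: "x \<noteq> b"
    have "\<not> height_le T 0 c x"
      using height0[OF x] support_in_D[of x c] \<open>c \<notin> D\<close> by blast
    have "x \<in> D"
    proof (cases "height_le T 1 c x")
      case True
      from height1[OF x this \<open>\<not> height_le T 0 c x\<close>] show ?thesis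
        using support_in_D by blast
    next
      case False
      from height2[OF x kid[OF x xv] this] show ?thesis by blast
    qed
    then show False using D_unique[OF _ d(8) x b(1)] xb by blast
  qed
  then have "open_nbhd T c = {v, b}" by (rule nbhd_pairI[OF vc b(1)])
  moreover have "v \<noteq> b" using b(2) by blast
  ultimately show ?thesis using d \<open>c \<notin> D\<close> by (intro exI conjI) assumption+
qed

text \<open>The child \<open>w\<close> of height 3 lies in \<open>P\<close>, which excludes
  \<open>c\<close> and every other child from \<open>P\<close>; also \<open>c\<close> is not in
  \<open>D\<close>. Of the possible heights of another child, 0 would need \<open>c\<close> in
  \<open>D\<close>, 2 would need \<open>c\<close> in \<open>P\<close>, and 3 would put the child
  itself into \<open>P\<close>. Only height 1 is left.\<close>

lemma no_height4:
  assumes tc: "(t, c) \<in> parcs T" and "height_le T (Suc 3) t c" and "\<not> height_le T 3 t c"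
  shows False
proof -
  from assms(3) obtain w where w: "(c, w) \<in> parcs T" "w \<noteq> t" "\<not> height_le T 2 c w"
    using not_height_child[of 2 t c] by (auto simp: numeral_3_eq_3 numeral_2_eq_2)
  have kid: "height_le T 3 c d" if "(c, d) \<in> parcs T" "d \<noteq> t" for d
    using height_child[OF assms(2) that] .
  from height3[OF w(1) kid[OF w(1,2)] w(3)] obtain x u v
    where x: "c \<noteq> x" "w \<noteq> u" "x \<noteq> v" "open_nbhd T w = {c, x}" "open_nbhd T x = {w, u}"
    "open_nbhd T u = {x, v}" "open_nbhd T v = {u}" "v \<in> P" "u \<in> D" "x \<in> D" "w \<in> P" "w \<notin> D" by blast
  have sw: "open_nbhd T w = {x, c}" "open_nbhd T x = {u, w}" "open_nbhd T u = {v, x}"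
    using x by auto
  have "c \<notin> D" using D_unique[of c x w] x nbhd_arc[OF x(4)] by auto
  have "c \<notin> P" using P_indep[OF _ x(11)] w(1) by blast
  have "d = w" if d: "(c, d) \<in> parcs T" and dt: "d \<noteq> t" for d
  proof (rule ccontr)
    assume "d \<noteq> w"
    then have "d \<notin> P" using P_unique[OF _ x(11) d w(1)] by blast
    have n0: "\<not> height_le T 0 c d"
      using height0[OF d] support_in_D[of d c] \<open>c \<notin> D\<close> by blast
    show False
    proof (cases "height_le T 1 c d")
      case True
      from height1[OF d this n0] obtain a where a: "c \<noteq> a" "open_nbhd T d = {c, a}" "open_nbhd T a = {d}"
        by blast
      \<comment> \<open>With \<open>c\<close> outside \<open>D\<close> and \<open>d\<close> outside
        \<open>P\<close>, the leaf \<open>a\<close> belongs to both sets. The two branches at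
        \<open>c\<close> form the path required by \<open>O\<^sub>5\<close>, with \<open>c\<close>
        in the middle.\<close>
      have "d \<in> D" by (rule support_in_D[OF a(3)])
      moreover have "a \<in> D" using D_ex[of d] nbhd_verts[OF a(2)] nbhd_arc[OF a(2)] \<open>c \<notin> D\<close> by auto
      moreover have "a \<in> P" using P_ex[of a] nbhd_verts[OF a(3)] nbhd_arc[OF a(3)] \<open>d \<notin> P\<close> by auto
      ultimately show False
        using no_O5[OF x(7) sw(3) sw(2) sw(1) a(2,3)] x by blast
    next
      case n1: False
      show False
      proof (cases "height_le T 2 c d")
        case True
        from height2[OF d this n1] show False using \<open>c \<notin> P\<close> by blast
      next
        case False
        from height3[OF d kid[OF d dt] this] show False using \<open>d \<notin> P\<close> by blast
      qed
    qed
  qed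
  then have "open_nbhd T c = {t, w}" by (rule nbhd_pairI[OF tc w(1)])
  then have "open_nbhd T c = {w, t}" by auto
  then show False
    using no_O3[OF x(7) sw(3) sw(2) sw(1)] x w by blast
qed

text \<open>Bounds of 3 for all children give a bound of 4 for the parent, and height exactly 4 is
  excluded; so any finite bound drops to 3.\<close>

lemma height_le_3: "(u, c) \<in> parcs T \<Longrightarrow> height_le T h u c \<Longrightarrow> height_le T 3 u c"
proof (induction h arbitrary: u c)
  case 0
  then show ?case by (auto simp: numeral_3_eq_3)
next
  case (Suc h)
  then have "\<forall>d\<in>open_nbhd T c - {u}. height_le T 3 c d" by auto
  then have "height_le T (Suc 3) u c" by (simp only: height_le.simps)
  with Suc.prems(1) show ?case using no_height4 by blast
qed

lemma complete_2: "K\<^bsub>2\<^esub> (with_proj T)"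
proof -
  have fin: "finite (pverts T)" and con: "\<forall>u\<in>pverts T. \<forall>v\<in>pverts T. (u, v) \<in> (parcs T)\<^sup>*"
    and "pverts T \<noteq> {}"
    using tree connected_iff[OF pair] pair by (auto simp: graph_tree_def pair_graph_iff)
  \<comment> \<open>An edge exists because every vertex has a neighbour in \<open>D\<close>.\<close>
  then obtain x y where "(x, y) \<in> parcs T" using D_ex by blast
  then have "\<exists>r s. open_nbhd T r = {s}"
    using height_le_imp_leaf[OF _ height_le_card[OF tree]] pair by (auto simp: pair_graph_iff)
  then obtain r c where r: "open_nbhd T r = {c}" by blast
  then have rc: "(r, c) \<in> parcs T" by auto
  have h3: "height_le T 3 r c"
    using height_le_3[OF rc height_le_card[OF tree rc]] .
  \<comment> \<open>From here the root \<open>r\<close> is itself a leaf at \<open>c\<close> and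
    removes one height at a time: it forces \<open>c\<close> into \<open>D\<close>, then serves as
    the leaf added by \<open>O\<^sub>4\<close>, then as a twin leaf.\<close>
  have h2: "height_le T 2 r c"
    using height3[OF rc h3] support_in_D[OF r] by blast
  have h1: "height_le T 1 r c"
  proof (rule ccontr)
    assume "\<not> ?thesis"
    from height2[OF rc h2 this] obtain b a where *: "open_nbhd T b = {c, a}" "open_nbhd T a = {b}"
      "a \<in> P" "b \<in> D" "c \<in> D" "r \<in> P" by blast
    then have "open_nbhd T b = {a, c}" by auto
    then show False using no_O4[OF *(2) _ r] * by blast
  qed
  have "height_le T 0 r c"
    using height1[OF rc h1] no_twin_leaves[OF r] by blast
  then have c: "open_nbhd T c = {r}" by (rule height0[OF rc])
  have "y \<in> {r, c}" if "(r, y) \<in> (parcs T)\<^sup>*" for y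
    using that by (induction) (use nbhd_arc[OF r] nbhd_arc[OF c] in auto)
  then have V: "pverts T = {r, c}" using con nbhd_verts[OF r] by auto
  have "r \<noteq> c" using rc by auto
  moreover have "parcs T = {(u, v). (u, v) \<in> pverts T \<times> pverts T \<and> u \<noteq> v}"
  proof (intro equalityI subrelI)
    fix x y assume xy: "(x, y) \<in> parcs T"
    then show "(x, y) \<in> {(u, v). (u, v) \<in> pverts T \<times> pverts T \<and> u \<noteq> v}"
      using arc_verts[OF xy] by auto
  next
    fix x y assume "(x, y) \<in> {(u, v). (u, v) \<in> pverts T \<times> pverts T \<and> u \<noteq> v}"
    then show "(x, y) \<in> parcs T" using rc arc_sym[OF rc] by (auto simp: V)
  qed
  ultimately show ?thesis
    using fin by (simp add: complete_digraph_pair_def V)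
qed

end

section \<open>Every EOCD tree is obtainable: induction on the number of vertices\<close>

lemma EOCD_step_card:
  assumes "EOCD_step G H" "graph_tree H"
  shows "card (pverts G) < card (pverts H)"
proof -
  obtain D P where "op_O1 G D P H \<or> op_O2 G D P H \<or> op_O3 G D P H \<or> op_O4 G D P H \<or> op_O5 G D P H"
    using assms(1) by (auto simp: EOCD_step_def)
  then have "pverts G \<subset> pverts H"
    unfolding op_O1_def op_O2_def op_O3_def op_O4_def op_O5_def by (elim disjE exE conjE) auto
  moreover have "finite (pverts H)" using assms(2) by (simp add: graph_tree_def pair_graph_iff)
  ultimately show ?thesis by (rule psubset_card_mono[rotated])
qed

lemma EOCD_tree_obtainable:
  "graph_tree T \<Longrightarrow> EOCD_graph T \<Longrightarrow> obtainable_from_K2 T"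
proof (induction "card (pverts T)" arbitrary: T rule: less_induct)
  case less
  show ?case
  proof (cases "\<exists>T'. graph_tree T' \<and> EOCD_graph T' \<and> EOCD_step T' T")
    case True
    then obtain T' where T': "graph_tree T'" "EOCD_graph T'" "EOCD_step T' T" by blast
    from less.hyps[OF EOCD_step_card[OF T'(3) less.prems(1)] T'(1,2)] T'(3) show ?thesis
      unfolding obtainable_from_K2_def by (meson rtranclp.rtrancl_into_rtrancl)
  next
    case False
    obtain D P where "EOD_set T D" "ECD_set T P" using less.prems(2) by (auto simp: EOCD_graph_def)
    moreover have "pair_graph T" using less.prems(2) by (simp add: EOCD_graph_def)
    ultimately interpret irreducible T D P
      using False less.prems(1) unfolding irreducible_def eocd_sets_def irreducible_axioms_def by blast
    show ?thesis using complete_2 unfolding obtainable_from_K2_def by blast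
  qed
qed

section \<open>The operations preserve EOCD graphs\<close>

lemma pair_graph_extend:
  assumes "pair_graph G" "finite W" "E \<subseteq> (pverts G \<union> W) \<times> (pverts G \<union> W)" "irrefl E"
  shows "pair_graph (extend G W E)"
proof -
  have "sym (parcs (extend G W E))"
    using assms(1) by (auto simp: pair_graph_iff sym_def)
  with assms show ?thesis
    unfolding pair_graph_iff by (auto simp: irrefl_def)
qed

text \<open>\<open>X\<close> collects the new members. None of them is adjacent to an old vertex, so
  old vertices keep their dominators, and only the new vertices have to be checked against the new
  edges.\<close>

lemma EOD_set_extend:
  assumes G: "pair_graph G" and H: "pair_graph (extend G W E)" and EOD: "EOD_set G D"
    and W: "W \<inter> pverts G = {}" and E: "\<And>a b. (a, b) \<in> E \<Longrightarrow> a \<in> W \<or> b \<in> W"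
    and X: "X \<subseteq> W" "\<And>v d. v \<in> pverts G \<Longrightarrow> d \<in> X \<Longrightarrow> (v, d) \<notin> E \<union> E\<inverse>"
    and new: "\<And>v. v \<in> W \<Longrightarrow> \<exists>!d. d \<in> D \<union> X \<and> (v, d) \<in> E \<union> E\<inverse>"
  shows "EOD_set (extend G W E) (D \<union> X)"
proof -
  have DG: "D \<subseteq> pverts G" and GG: "parcs G \<subseteq> pverts G \<times> pverts G"
    using EOD G by (auto simp: EOD_set_iff pair_graph_iff)
  have "\<exists>!d. d \<in> D \<union> X \<and> (v, d) \<in> parcs (extend G W E)" if "v \<in> pverts G \<union> W" for v
  proof (cases "v \<in> W")
    case True
    then have "(v, d) \<in> parcs (extend G W E) \<longleftrightarrow> (v, d) \<in> E \<union> E\<inverse>" for d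
      using GG W by auto
    then show ?thesis using new[OF True] by simp
  next
    case False
    then have v: "v \<in> pverts G" using that by simp
    have "d \<in> D \<union> X \<and> (v, d) \<in> parcs (extend G W E) \<longleftrightarrow> d \<in> D \<and> (v, d) \<in> parcs G" for d
      using X(1) X(2)[OF v, of d] E[of v d] E[of d v] False DG GG W by auto
    then show ?thesis using EOD v by (simp add: EOD_set_iff[OF G])
  qed
  then show ?thesis
    using DG X(1) by (auto simp: EOD_set_iff[OF H])
qed

lemma ECD_set_extend:
  assumes G: "pair_graph G" and H: "pair_graph (extend G W E)" and ECD: "ECD_set G P"
    and W: "W \<inter> pverts G = {}" and E: "\<And>a b. (a, b) \<in> E \<Longrightarrow> a \<in> W \<or> b \<in> W"
    and X: "X \<subseteq> W" "\<And>v p. v \<in> pverts G \<Longrightarrow> p \<in> X \<Longrightarrow> (v, p) \<notin> E \<union> E\<inverse>"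
    and new: "\<And>v. v \<in> W \<Longrightarrow> \<exists>!p. p \<in> P \<union> X \<and> (p = v \<or> (v, p) \<in> E \<union> E\<inverse>)"
  shows "ECD_set (extend G W E) (P \<union> X)"
proof -
  have PG: "P \<subseteq> pverts G" and GG: "parcs G \<subseteq> pverts G \<times> pverts G"
    using ECD G by (auto simp: ECD_set_iff pair_graph_iff)
  have "\<exists>!p. p \<in> P \<union> X \<and> (p = v \<or> (v, p) \<in> parcs (extend G W E))" if "v \<in> pverts G \<union> W" for v
  proof (cases "v \<in> W")
    case True
    then have "(v, p) \<in> parcs (extend G W E) \<longleftrightarrow> (v, p) \<in> E \<union> E\<inverse>" for p
      using GG W by auto
    then show ?thesis using new[OF True] by simp
  next
    case False
    then have v: "v \<in> pverts G" using that by simp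
    have "p \<in> P \<union> X \<and> (p = v \<or> (v, p) \<in> parcs (extend G W E)) \<longleftrightarrow> p \<in> P \<and> (p = v \<or> (v, p) \<in> parcs G)" for p
      using X(1) X(2)[OF v, of p] E[of v p] E[of p v] False PG GG W by auto
    then show ?thesis using ECD v by (simp add: ECD_set_iff[OF G])
  qed
  then show ?thesis
    using PG X(1) by (auto simp: ECD_set_iff[OF H])
qed

lemma degree_1_nbhd: "degree G v = 1 \<Longrightarrow> (v, u) \<in> parcs G \<Longrightarrow> open_nbhd G v = {u}"
  unfolding degree_eq_card by (metis card_1_singletonE open_nbhd_iff singletonD)

lemma degree_2_nbhd:
  assumes "degree G u = 2" "(u, v) \<in> parcs G" "(u, x) \<in> parcs G" "v \<noteq> x"
  shows "open_nbhd G u = {v, x}"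
proof -
  obtain a b where "open_nbhd G u = {a, b}"
    using assms(1) unfolding degree_eq_card card_2_iff by blast
  moreover have "v \<in> open_nbhd G u" "x \<in> open_nbhd G u" using assms(2,3) by simp_all
  ultimately show ?thesis using assms(4) by auto
qed

section \<open>The five operations one by one\<close>

context eocd_sets
begin

lemma EOCD_O1:
  assumes "op_O1 T D P H"
  shows "EOCD_graph H"
proof -
  from assms obtain u v where u: "u \<in> D" "u \<in> P" and v: "v \<notin> pverts T" and H: "H = extend T {v} {(u, v)}"
    unfolding op_O1_def by blast
  have uv: "u \<noteq> v" "u \<in> pverts T" using D_verts[OF u(1)] v by auto
  have pH: "pair_graph H"
    unfolding H by (rule pair_graph_extend[OF pair]) (use uv in \<open>auto simp: irrefl_def\<close>)
  have "EOD_set H (D \<union> {})"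
    unfolding H by (rule EOD_set_extend[OF pair pH[unfolded H] EOD]) (use u v uv in auto)
  moreover have "ECD_set H (P \<union> {})"
    unfolding H by (rule ECD_set_extend[OF pair pH[unfolded H] ECD]) (use u v uv P_verts in auto)
  ultimately show ?thesis using pH unfolding EOCD_graph_def by blast
qed

lemma EOCD_O2:
  assumes "op_O2 T D P H"
  shows "EOCD_graph H"
proof -
  from assms obtain w x u v where w: "w \<in> pverts T" "w \<notin> D" and d: "distinct [x, u, v]"
    and new: "{x, u, v} \<inter> pverts T = {}" and H: "H = extend T {x, u, v} {(x, u), (u, v), (w, x)}"
    unfolding op_O2_def by blast
  have dist: "distinct [w, x, u, v]" using w d new by auto
  have pH: "pair_graph H"
    unfolding H by (rule pair_graph_extend[OF pair]) (use dist w in \<open>auto simp: irrefl_def\<close>)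
  have n: "x \<notin> D" "u \<notin> D" "v \<notin> D" "x \<notin> P" "u \<notin> P" "v \<notin> P" using D_verts P_verts new by auto
  \<comment> \<open>Since \<open>w\<close> is not in \<open>D\<close>, the vertex \<open>x\<close>
    has \<open>u\<close> as its only dominator.\<close>
  have "EOD_set H (D \<union> {u, v})"
    unfolding H
  proof (rule EOD_set_extend[OF pair pH[unfolded H] EOD])
    fix c assume "c \<in> {x, u, v}"
    then consider "c = x" | "c = u" | "c = v" by blast
    then show "\<exists>!d. d \<in> D \<union> {u, v} \<and> (c, d) \<in> {(x, u), (u, v), (w, x)} \<union> {(x, u), (u, v), (w, x)}\<inverse>"
    proof cases
      case 1
      show ?thesis by (rule ex1I[of _ u]) (use 1 dist w n in auto)
    next
      case 2
      show ?thesis by (rule ex1I[of _ v]) (use 2 dist w n in auto)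
    next
      case 3
      show ?thesis by (rule ex1I[of _ u]) (use 3 dist w n in auto)
    qed
  qed (use dist w new in auto)
  \<comment> \<open>If \<open>w\<close> is in \<open>P\<close> it already dominates
    \<open>x\<close>, and \<open>v\<close> serves \<open>u\<close> and \<open>v\<close>; otherwise
    \<open>u\<close> serves the whole new path.\<close>
  moreover have "ECD_set H (P \<union> {if w \<in> P then v else u})"
    unfolding H
  proof (rule ECD_set_extend[OF pair pH[unfolded H] ECD])
    fix c assume "c \<in> {x, u, v}"
    then consider "c = x" | "c = u" | "c = v" by blast
    then show "\<exists>!p. p \<in> P \<union> {if w \<in> P then v else u} \<and> (p = c \<or> (c, p) \<in> {(x, u), (u, v), (w, x)} \<union> {(x, u), (u, v), (w, x)}\<inverse>)"
    proof cases
      case 1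
      show ?thesis by (rule ex1I[of _ "if w \<in> P then w else u"]) (use 1 dist n in \<open>auto split: if_splits\<close>)
    next
      case 2
      show ?thesis by (rule ex1I[of _ "if w \<in> P then v else u"]) (use 2 dist n in \<open>auto split: if_splits\<close>)
    next
      case 3
      show ?thesis by (rule ex1I[of _ "if w \<in> P then v else u"]) (use 3 dist n in \<open>auto split: if_splits\<close>)
    qed
  qed (use dist w new in \<open>auto split: if_splits\<close>)
  ultimately show ?thesis using pH unfolding EOCD_graph_def by blast
qed

lemma EOCD_O3:
  assumes "op_O3 T D P H"
  shows "EOCD_graph H"
proof -
  from assms obtain t z w x u v where t: "t \<in> D" "t \<notin> P" and d: "distinct [z, w, x, u, v]"
    and new: "{z, w, x, u, v} \<inter> pverts T = {}"
    and H: "H = extend T {z, w, x, u, v} {(z, w), (w, x), (x, u), (u, v), (t, z)}"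
    unfolding op_O3_def by blast
  have dist: "distinct [t, z, w, x, u, v]" and tT: "t \<in> pverts T" using D_verts[OF t(1)] d new by auto
  have pH: "pair_graph H"
    unfolding H by (rule pair_graph_extend[OF pair]) (use dist tT in \<open>auto simp: irrefl_def\<close>)
  have n: "z \<notin> D" "w \<notin> D" "x \<notin> D" "u \<notin> D" "v \<notin> D" "z \<notin> P" "w \<notin> P" "x \<notin> P" "u \<notin> P" "v \<notin> P"
    using D_verts P_verts new by auto
  have "EOD_set H (D \<union> {x, u})"
    unfolding H
  proof (rule EOD_set_extend[OF pair pH[unfolded H] EOD])
    fix c assume "c \<in> {z, w, x, u, v}"
    then consider "c = z" | "c = w" | "c = x" | "c = u" | "c = v" by blast
    then show "\<exists>!d. d \<in> D \<union> {x, u} \<and> (c, d) \<in> {(z, w), (w, x), (x, u), (u, v), (t, z)} \<union> {(z, w), (w, x), (x, u), (u, v), (t, z)}\<inverse>"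
    proof cases
      case 1
      show ?thesis by (rule ex1I[of _ t]) (use 1 dist t n in auto)
    next
      case 2
      show ?thesis by (rule ex1I[of _ x]) (use 2 dist t n in auto)
    next
      case 3
      show ?thesis by (rule ex1I[of _ u]) (use 3 dist t n in auto)
    next
      case 4
      show ?thesis by (rule ex1I[of _ x]) (use 4 dist t n in auto)
    next
      case 5
      show ?thesis by (rule ex1I[of _ u]) (use 5 dist t n in auto)
    qed
  qed (use dist tT new in auto)
  \<comment> \<open>\<open>w\<close> serves \<open>z\<close>, \<open>w\<close>, \<open>x\<close>,
    and \<open>v\<close> serves \<open>u\<close>, \<open>v\<close>; as \<open>t\<close> is not in
    \<open>P\<close>, it does not dominate \<open>z\<close> a second time.\<close>
  moreover have "ECD_set H (P \<union> {w, v})"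
    unfolding H
  proof (rule ECD_set_extend[OF pair pH[unfolded H] ECD])
    fix c assume "c \<in> {z, w, x, u, v}"
    then consider "c = z" | "c = w" | "c = x" | "c = u" | "c = v" by blast
    then show "\<exists>!p. p \<in> P \<union> {w, v} \<and> (p = c \<or> (c, p) \<in> {(z, w), (w, x), (x, u), (u, v), (t, z)} \<union> {(z, w), (w, x), (x, u), (u, v), (t, z)}\<inverse>)"
    proof cases
      case 1
      show ?thesis by (rule ex1I[of _ w]) (use 1 dist t n in auto)
    next
      case 2
      show ?thesis by (rule ex1I[of _ w]) (use 2 dist t n in auto)
    next
      case 3
      show ?thesis by (rule ex1I[of _ w]) (use 3 dist t n in auto)
    next
      case 4
      show ?thesis by (rule ex1I[of _ v]) (use 4 dist t n in auto)
    next
      case 5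
      show ?thesis by (rule ex1I[of _ v]) (use 5 dist t n in auto)
    qed
  qed (use dist tT new in auto)
  ultimately show ?thesis using pH unfolding EOCD_graph_def by blast
qed

lemma EOCD_O4:
  assumes "op_O4 T D P H"
  shows "EOCD_graph H"
proof -
  from assms obtain v u x y where vp: "vpath [v, u, x] (with_proj T)"
    and deg: "degree T v = 1" "degree T u = 2" and D: "x \<in> D" and P: "u \<in> P"
    and y: "y \<notin> pverts T" and H: "H = extend T {y} {(y, x)}"
    unfolding op_O4_def by blast
  have arcs: "(v, u) \<in> parcs T" "(u, x) \<in> parcs T" and vx: "v \<noteq> x"
    using vp by (auto simp: vpath_def vwalk_def)
  have v: "open_nbhd T v = {u}" by (rule degree_1_nbhd[OF deg(1) arcs(1)])
  have u: "open_nbhd T u = {v, x}" by (rule degree_2_nbhd[OF deg(2) arc_sym[OF arcs(1)] arcs(2) vx])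
  have V: "v \<in> pverts T" "u \<in> pverts T" "x \<in> pverts T"
    using nbhd_verts[OF u] by simp_all
  note A = nbhd_arc[OF v] nbhd_arc[OF u] nbhd_arc'[OF v] nbhd_arc'[OF u]
  have nP: "v \<notin> P" "x \<notin> P" "y \<notin> P" using P_indep[OF P] A P_verts y by auto
  have nA: "(y, w) \<notin> parcs T" "(w, y) \<notin> parcs T" for w using arc_verts y by blast+
  have dist: "distinct [v, u, x, y]"
    using V y vx A arcs P nP by auto
  have pH: "pair_graph H"
    unfolding H by (rule pair_graph_extend[OF pair]) (use V dist in \<open>auto simp: irrefl_def\<close>)
  have "EOD_set H (D \<union> {})"
    unfolding H by (rule EOD_set_extend[OF pair pH[unfolded H] EOD]) (use V D dist y in auto)
  moreover
  \<comment> \<open>The inverse of the exchange in \<open>no_O4\<close>: the three vertices served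
    by \<open>u\<close> are divided between \<open>v\<close> and \<open>y\<close>. As
    \<open>P\<close> loses a member, \<open>ECD_set_extend\<close> does not apply and dominators are
    checked vertex by vertex.\<close>
  let ?P = "{v, y} \<union> (P - {u})"
  have "\<exists>!p. p \<in> ?P \<and> (p = c \<or> (c, p) \<in> parcs H)" if "c \<in> pverts H" for c
  proof -
    consider "c = y" | "c = x" | "c = u" | "c = v" | "c \<in> pverts T" "c \<notin> {x, u, v, y}"
      using \<open>c \<in> pverts H\<close> by (auto simp: H)
    then show ?thesis
    proof cases
      case 1
      show ?thesis by (rule ex1I[of _ y]) (use 1 dist nP nA in \<open>auto simp: H\<close>)
    next
      case 2
      have "p = u" if "p \<in> P" "(x, p) \<in> parcs T" for p
        using P_unique[OF that(1) P that(2)] A by simp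
      then show ?thesis by (intro ex1I[of _ y]) (use 2 dist nP A in \<open>auto simp: H\<close>)
    next
      case 3
      show ?thesis by (rule ex1I[of _ v]) (use 3 dist nP A in \<open>auto simp: H\<close>)
    next
      case 4
      show ?thesis by (rule ex1I[of _ v]) (use 4 dist nP A in \<open>auto simp: H\<close>)
    next
      case 5
      then have "p \<in> ?P \<and> (p = c \<or> (c, p) \<in> parcs H) \<longleftrightarrow> p \<in> P \<and> (p = c \<or> (c, p) \<in> parcs T)" for p
        using A nA P_verts y by (auto simp: H)
      then show ?thesis using P_ex1[OF 5(1)] by simp
    qed
  qed
  then have "ECD_set H ?P"
    unfolding ECD_set_iff[OF pH] using P_verts V by (auto simp: H)
  ultimately show ?thesis using pH unfolding EOCD_graph_def by blast
qed

lemma EOCD_O5: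
  assumes "op_O5 T D P H"
  shows "EOCD_graph H"
proof -
  from assms obtain u x w z w' x' v where vp: "vpath [u, x, w, z, w', x'] (with_proj T)"
    and deg: "degree T u = 1" "degree T x' = 1" "degree T x = 2" "degree T w = 2" "degree T w' = 2"
    and D: "u \<in> D" and P: "x \<in> P" "w' \<in> P"
    and v: "v \<notin> pverts T" and H: "H = extend T {v} {(u, v)}"
    unfolding op_O5_def by blast
  have arcs: "(u, x) \<in> parcs T" "(x, w) \<in> parcs T" "(w, z) \<in> parcs T" "(z, w') \<in> parcs T" "(w', x') \<in> parcs T"
    and dist': "distinct [u, x, w, z, w', x']"
    using vp by (auto simp: vpath_def vwalk_def)
  have u: "open_nbhd T u = {x}" by (rule degree_1_nbhd[OF deg(1) arcs(1)])
  have x': "open_nbhd T x' = {w'}" by (rule degree_1_nbhd[OF deg(2) arc_sym[OF arcs(5)]])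
  have x: "open_nbhd T x = {u, w}"
    by (rule degree_2_nbhd[OF deg(3) arc_sym[OF arcs(1)] arcs(2)]) (use dist' in simp)
  have w: "open_nbhd T w = {x, z}"
    by (rule degree_2_nbhd[OF deg(4) arc_sym[OF arcs(2)] arcs(3)]) (use dist' in simp)
  have w': "open_nbhd T w' = {z, x'}"
    by (rule degree_2_nbhd[OF deg(5) arc_sym[OF arcs(4)] arcs(5)]) (use dist' in simp)
  have V: "u \<in> pverts T" "x \<in> pverts T" "w \<in> pverts T" "z \<in> pverts T" "w' \<in> pverts T" "x' \<in> pverts T"
    using nbhd_verts[OF x] nbhd_verts[OF w] nbhd_verts[OF w'] by simp_all
  have dist: "distinct [u, x, w, z, w', x', v]" using dist' V v by auto
  note A = nbhd_arc[OF u] nbhd_arc[OF x] nbhd_arc[OF w] nbhd_arc[OF w'] nbhd_arc[OF x']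
    nbhd_arc'[OF u] nbhd_arc'[OF x] nbhd_arc'[OF w] nbhd_arc'[OF w'] nbhd_arc'[OF x']
  have nP: "u \<notin> P" "w \<notin> P" "z \<notin> P" "x' \<notin> P" "v \<notin> P"
    using P_indep[OF P(1)] P_indep[OF P(2)] A P_verts v by auto
  have nA: "(v, y) \<notin> parcs T" "(y, v) \<notin> parcs T" for y using arc_verts v by blast+
  have pH: "pair_graph H"
    unfolding H by (rule pair_graph_extend[OF pair]) (use V dist in \<open>auto simp: irrefl_def\<close>)
  have "EOD_set H (D \<union> {})"
    unfolding H by (rule EOD_set_extend[OF pair pH[unfolded H] EOD]) (use V D dist v in auto)
  moreover
  \<comment> \<open>The inverse of the shift in \<open>no_O5\<close>, making room for
    \<open>v\<close> at the end of the path.\<close>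
  let ?P = "{v, w, x'} \<union> (P - {x, w'})"
  have "\<exists>!p. p \<in> ?P \<and> (p = c \<or> (c, p) \<in> parcs H)" if "c \<in> pverts H" for c
  proof -
    consider "c = v" | "c = u" | "c = x" | "c = w" | "c = z" | "c = w'" | "c = x'"
      | "c \<in> pverts T" "c \<notin> {v, u, x, w, z, w', x'}"
      using \<open>c \<in> pverts H\<close> by (auto simp: H)
    then show ?thesis
    proof cases
      case 1
      show ?thesis by (rule ex1I[of _ v]) (use 1 dist nP nA in \<open>auto simp: H\<close>)
    next
      case 2
      show ?thesis by (rule ex1I[of _ v]) (use 2 dist nP A in \<open>auto simp: H\<close>)
    next
      case 3
      show ?thesis by (rule ex1I[of _ w]) (use 3 dist nP A in \<open>auto simp: H\<close>)
    next
      case 4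
      show ?thesis by (rule ex1I[of _ w]) (use 4 dist nP A in \<open>auto simp: H\<close>)
    next
      case 5
      have "p = w'" if "p \<in> P" "(z, p) \<in> parcs T" for p
        using P_unique[OF that(1) P(2) that(2)] A by simp
      then show ?thesis by (intro ex1I[of _ w]) (use 5 dist nP nA A in \<open>auto simp: H\<close>)
    next
      case 6
      show ?thesis by (rule ex1I[of _ x']) (use 6 dist nP A in \<open>auto simp: H\<close>)
    next
      case 7
      show ?thesis by (rule ex1I[of _ x']) (use 7 dist nP A in \<open>auto simp: H\<close>)
    next
      case 8
      then have "p \<in> ?P \<and> (p = c \<or> (c, p) \<in> parcs H) \<longleftrightarrow> p \<in> P \<and> (p = c \<or> (c, p) \<in> parcs T)" for p
        using A nA P_verts v by (auto simp: H)
      then show ?thesis using P_ex1[OF 8(1)] by simp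
    qed
  qed
  then have "ECD_set H ?P"
    unfolding ECD_set_iff[OF pH] using P_verts V by (auto simp: H)
  ultimately show ?thesis using pH unfolding EOCD_graph_def by blast
qed

end

section \<open>Soundness of a step, the starting graph and the equivalence\<close>

lemma EOCD_step_EOCD:
  assumes "EOCD_step G H"
  shows "EOCD_graph H"
proof -
  obtain D P where "graph_tree G" "EOD_set G D" "ECD_set G P"
    and op: "op_O1 G D P H \<or> op_O2 G D P H \<or> op_O3 G D P H \<or> op_O4 G D P H \<or> op_O5 G D P H"
    using assms unfolding EOCD_step_def by blast
  then interpret eocd_sets G D P
    unfolding eocd_sets_def graph_tree_def by blast
  from op show ?thesis
    using EOCD_O1 EOCD_O2 EOCD_O3 EOCD_O4 EOCD_O5 by (elim disjE)
qed

lemma EOCD_K2: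
  assumes "K\<^bsub>2\<^esub> (with_proj K)"
  shows "EOCD_graph K"
proof -
  have K: "pair_graph K" using assms pair_graphI_complete by blast
  obtain a b where ab: "a \<noteq> b" "pverts K = {a, b}" "parcs K = {(a, b), (b, a)}"
    using assms unfolding complete_digraph_pair_def card_2_iff by auto
  have "EOD_set K {a, b}" "ECD_set K {a}"
    unfolding EOD_set_iff[OF K] ECD_set_iff[OF K] using ab by auto
  with K show ?thesis unfolding EOCD_graph_def by blast
qed

theorem theorem4p1:
  fixes T :: "'a pair_pre_digraph"
  assumes "graph_tree T"
  shows "EOCD_graph T \<longleftrightarrow> obtainable_from_K2 T"
proof
  assume "obtainable_from_K2 T"
  then obtain K where K: "K\<^bsub>2\<^esub> (with_proj K)" and "EOCD_step\<^sup>*\<^sup>* K T"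
    unfolding obtainable_from_K2_def by blast
  \<comment> \<open>It suffices to look at the end of the sequence: either it is empty and
    \<open>T\<close> is \<open>K\<close>, or its last step makes \<open>T\<close> an EOCD
    graph.\<close>
  from this(2) show "EOCD_graph T"
    by (cases rule: rtranclp.cases) (use K EOCD_K2 EOCD_step_EOCD in auto)
qed (rule EOCD_tree_obtainable[OF assms])

end
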